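(* Let $U_1\in\mathbb{C}^{m\times m}$ be unitary, let $\Omega\in\mathbb{C}^{m\times m}$ be skew-Hermitian, and let $U_2=U_1e^{t\Omega}$. Assume that $(1-s)U_1+sU_2$ is nonsingular for each $s\in[0,1]$. Then $$\mathcal{P}((1-s)U_1+sU_2)=U_1e^{st\Omega}+O(t^3)$$ for every $s\in[0,1/2)\cup(1/2,1]$. When $s=1/2$, the equality $\mathcal{P}((1-s)U_1+sU_2)=U_1e^{st\Omega}$ holds exactly.
   Context: For a nonsingular $A\in\mathbb{C}^{m\times m}$, $\mathcal{P}(A)=U$ denotes the unitary factor in the polar decomposition $A=UH$, where $U$ is unitary and $H$ is Hermitian positive-definite. Here $t$ is a scalar (so $U_2$ depends on $t$), and $O(\cdot)$ is understood as $t\to0$.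
   Formalization: Here t is real, and nonsingularity of (1-s)U_1+sU_2 for s in [0,1] is assumed for all t in an interval containing 0, not for one isolated t; otherwise the exact equality at s=1/2 can fail (m=1, U_1=1, Ω=i, t=3π/2). *)

theory Defs
  imports "HOL-Analysis.Analysis" "HOL-Library.Landau_Symbols"
begin

definition adjoint_matrix :: "complex^'n^'m \<Rightarrow> complex^'m^'n" where
  "adjoint_matrix A = (\<chi> i j. cnj (A $ j $ i))"

definition unitary_matrix :: "complex^'m^'m \<Rightarrow> bool" where
  "unitary_matrix U \<longleftrightarrow>
     adjoint_matrix U ** U = mat 1 \<and> U ** adjoint_matrix U = mat 1"

definition hermitian_matrix :: "complex^'m^'m \<Rightarrow> bool" where
  "hermitian_matrix A \<longleftrightarrow> adjoint_matrix A = A"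

definition skew_hermitian_matrix :: "complex^'m^'m \<Rightarrow> bool" where
  "skew_hermitian_matrix A \<longleftrightarrow> adjoint_matrix A = - A"

(* For Hermitian A the form x^* A x is real, so its real part is the form itself. *)
definition hermitian_pos_def :: "complex^'m^'m \<Rightarrow> bool" where
  "hermitian_pos_def A \<longleftrightarrow> hermitian_matrix A \<and>
     (\<forall>x. x \<noteq> 0 \<longrightarrow> 0 < Re (\<Sum>i\<in>UNIV. cnj (x $ i) * (A *v x) $ i))"

(* The unitary polar factor P(A); meaningful for nonsingular A, where the polar
   decomposition A = U H exists and is unique. *)
definition polar_unitary :: "complex^'m^'m \<Rightarrow> complex^'m^'m" where
  "polar_unitary A =
     (THE U. unitary_matrix U \<and> (\<exists>H. hermitian_pos_def H \<and> A = U ** H))"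

(* The products of the type class structure on complex^'m^'m are componentwise,
   hence the powers are taken explicitly with respect to matrix multiplication. *)
definition matrix_pow :: "complex^'m^'m \<Rightarrow> nat \<Rightarrow> complex^'m^'m" where
  "matrix_pow A k = (((**) A) ^^ k) (mat 1)"

definition matrix_exp :: "complex^'m^'m \<Rightarrow> complex^'m^'m" where
  "matrix_exp A = (\<Sum>k. (1 / fact k) *\<^sub>R matrix_pow A k)"

end

theory Submission
  imports Defs
begin

text \<open>
  Diagonalising \<open>\<Omega> = V diag(i \<theta>\<^sub>j) V\<^sup>*\<close> reduces everything to scalars: the chord is
  \<open>U\<^sub>1 V diag(z\<^sub>j) V\<^sup>*\<close> with \<open>z\<^sub>j = 1 - s + s e\<^bsup>i t \<theta>\<^sub>j\<^esup>\<close>, its unitary polar factor replaces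
  \<open>z\<^sub>j\<close> by \<open>z\<^sub>j / |z\<^sub>j|\<close>, and the claim compares this phase with \<open>e\<^bsup>i s t \<theta>\<^sub>j\<^esup>\<close>. The
  imaginary part of \<open>z\<^sub>j e\<^bsup>-i s t \<theta>\<^sub>j\<^esup>\<close> is odd in \<open>t\<close> and has no linear term, which gives the
  order three.
  For \<open>s = 1/2\<close> one has \<open>z\<^sub>j = cos (t \<theta>\<^sub>j / 2) e\<^bsup>i t \<theta>\<^sub>j / 2\<^esup>\<close>; the cosine is positive because it
  does not vanish on the interval \<open>T\<close> and equals 1 at \<open>0\<close>.
\<close>

section \<open>Spectral theorem for Hermitian and skew-Hermitian matrices\<close>

text \<open>First-order condition at a minimum: near 0 the linear term dominates, so a nonzero slope
  would produce a negative value.\<close>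

lemma linear_plus_quadratic_nonneg:
  fixes a b :: real
  assumes "\<And>t. 0 \<le> t * a + t\<^sup>2 * b"
  shows "a = 0"
proof (rule ccontr)
  assume "a \<noteq> 0"
  define c where "c = \<bar>b\<bar> + 1"
  have c: "c > 0" "b < c" by (auto simp: c_def)
  \<comment> \<open>Taking \<open>c > b\<close> rather than \<open>b\<close> itself keeps
    \<open>c\<close> positive and makes the value at \<open>- a / c\<close> strictly
    negative.\<close>
  have "(- a / c) * a + (- a / c)\<^sup>2 * b = a\<^sup>2 / c\<^sup>2 * (b - c)"
    using c by (simp add: field_simps power2_eq_square)
  moreover have "\<dots> < 0"
    using \<open>a \<noteq> 0\<close> c by (intro mult_pos_neg) auto
  ultimately show False using assms[of "- a / c"] by simp
qed

text \<open>The quadratic form attains its maximum on the compact unit sphere of \<open>W\<close>,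
  and a maximiser is an eigenvector whose eigenvalue is the maximum.\<close>

lemma selfadjoint_eigenvector:
  fixes f :: "'a::euclidean_space \<Rightarrow> 'a"
  assumes f: "linear f" and sa: "\<And>x y. x \<bullet> f y = f x \<bullet> y"
    and W: "subspace W" "f ` W \<subseteq> W" and u: "u \<in> W" "u \<noteq> 0"
  obtains x c where "x \<in> W" "norm x = 1" "f x = c *\<^sub>R x"
proof -
  let ?S = "W \<inter> sphere 0 1"
  have "compact ?S"
    using W(1) by (intro closed_Int_compact closed_subspace) auto
  moreover have "(1 / norm u) *\<^sub>R u \<in> ?S"
    using u W(1) by (auto simp: subspace_scale)
  moreover have "continuous_on ?S (\<lambda>x. x \<bullet> f x)"
    using f by (intro continuous_intros linear_continuous_on)
      (simp add: linear_conv_bounded_linear)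
  ultimately obtain x where x: "x \<in> ?S" and max: "\<And>y. y \<in> ?S \<Longrightarrow> y \<bullet> f y \<le> x \<bullet> f x"
    by (metis continuous_attains_sup empty_iff)
  define c where "c = x \<bullet> f x"
  have le: "y \<bullet> f y \<le> c * (y \<bullet> y)" if "y \<in> W" for y
  proof (cases "y = 0")
    case False
    have "(1 / norm y) *\<^sub>R y \<in> ?S"
      using False that W(1) by (auto simp: subspace_scale)
    from max[OF this] False show ?thesis
      by (simp add: c_def linear_scale[OF f] field_simps dot_square_norm power2_eq_square)
  qed (simp add: linear_0[OF f])
  \<comment> \<open>\<open>y\<close> is half the gradient at \<open>x\<close> of the form
    \<open>c * (x \<bullet> x) - x \<bullet> f x\<close>. This form is nonnegative on
    \<open>W\<close> and vanishes at the maximiser, so its derivative in the direction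
    \<open>y\<close>, which is \<open>2 * (y \<bullet> y)\<close>, must be 0.\<close>
  define y where "y = c *\<^sub>R x - f x"
  have xW: "x \<in> W" and nx: "norm x = 1" using x by auto
  have yW: "y \<in> W"
    unfolding y_def using xW W by (intro subspace_diff subspace_scale) auto
  have "2 * (y \<bullet> y) = 0"
  proof (rule linear_plus_quadratic_nonneg)
    fix t :: real
    have xx: "c * (x \<bullet> x) = x \<bullet> f x" using nx by (simp add: c_def dot_square_norm)
    have "x + t *\<^sub>R y \<in> W"
      using xW yW W(1) by (intro subspace_add subspace_scale)
    from le[OF this]
    have "0 \<le> c * ((x + t *\<^sub>R y) \<bullet> (x + t *\<^sub>R y)) - (x + t *\<^sub>R y) \<bullet> f (x + t *\<^sub>R y)"
      by simp
    also have "\<dots> = t * (2 * (c * (x \<bullet> y) - f x \<bullet> y)) + t\<^sup>2 * (c * (y \<bullet> y) - y \<bullet> f y)"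
      using xx sa[of x y]
      by (simp add: linear_add[OF f] linear_scale[OF f] inner_add_left inner_add_right
          inner_commute algebra_simps power2_eq_square)
    also have "c * (x \<bullet> y) - f x \<bullet> y = y \<bullet> y"
      by (subst (3) y_def) (simp add: inner_diff_left)
    finally show "0 \<le> t * (2 * (y \<bullet> y)) + t\<^sup>2 * (c * (y \<bullet> y) - y \<bullet> f y)" .
  qed
  then have "f x = c *\<^sub>R x" by (simp add: y_def)
  with xW nx show thesis using that by blast
qed

text \<open>The inner product \<open>\<bullet>\<close> on complex vectors is the real one and sees
  only the real part of this Hermitian form.\<close>

definition cinner :: "complex^'n \<Rightarrow> complex^'n \<Rightarrow> complex" where
  "cinner x y = (\<Sum>i\<in>UNIV. cnj (x $ i) * y $ i)"

lemma Re_cinner: "Re (cinner x y) = x \<bullet> y"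
  by (simp add: cinner_def inner_vec_def inner_complex_def)

lemma Im_cinner: "Im (cinner x y) = (\<i> *s x) \<bullet> y"
  by (simp add: cinner_def inner_vec_def inner_complex_def)

lemma cinner_eq_0_iff: "cinner x y = 0 \<longleftrightarrow> x \<bullet> y = 0 \<and> (\<i> *s x) \<bullet> y = 0"
  by (simp add: complex_eq_iff Re_cinner Im_cinner)

lemma cnj_cinner: "cnj (cinner x y) = cinner y x"
  by (simp add: cinner_def mult.commute)

lemma cinner_self: "cinner x x = of_real ((norm x)\<^sup>2)"
  using arg_cong[OF cnj_cinner[of x x], of Im]
  by (simp add: complex_eq_iff Re_cinner dot_square_norm)

lemma cinner_matrix_vector: "cinner x (A *v y) = cinner (adjoint_matrix A *v x) y"
  unfolding cinner_def adjoint_matrix_def matrix_vector_mult_def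
  by (simp add: sum_distrib_left sum_distrib_right mult_ac) (rule sum.swap)

lemma hermitian_inner:
  assumes "hermitian_matrix A"
  shows "x \<bullet> (A *v y) = (A *v x) \<bullet> y"
  using assms by (metis Re_cinner cinner_matrix_vector hermitian_matrix_def)

lemma adjoint_mult: "adjoint_matrix (A ** B) = adjoint_matrix B ** adjoint_matrix A"
  by (simp add: adjoint_matrix_def matrix_matrix_mult_def vec_eq_iff mult.commute)

lemma unitary_mult:
  assumes "unitary_matrix A" "unitary_matrix B"
  shows "unitary_matrix (A ** B)"
  using assms unfolding unitary_matrix_def adjoint_mult
  by (metis matrix_mul_assoc matrix_mul_lid)

text \<open>Induction on \<open>k\<close>: the orthogonal complement of the eigenvectors found so
  far is invariant under \<open>A\<close>, and the next eigenvector is taken from it.\<close>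

lemma hermitian_orthonormal_eigenvectors:
  fixes A :: "complex^'m^'m"
  assumes A: "hermitian_matrix A" and "k \<le> CARD('m)"
  shows "\<exists>B. finite B \<and> card B = k \<and>
           (\<forall>b\<in>B. norm b = 1 \<and> (\<exists>c. A *v b = c *\<^sub>R b)) \<and>
           (\<forall>b\<in>B. \<forall>b'\<in>B. b \<noteq> b' \<longrightarrow> cinner b b' = 0)"
  using assms(2)
proof (induction k)
  case 0
  show ?case by (intro exI[of _ "{}"]) auto
next
  case (Suc k)
  then obtain B where B: "finite B" "card B = k"
    "\<And>b. b \<in> B \<Longrightarrow> norm b = 1 \<and> (\<exists>c. A *v b = c *\<^sub>R b)"
    "\<And>b b'. b \<in> B \<Longrightarrow> b' \<in> B \<Longrightarrow> b \<noteq> b' \<Longrightarrow> cinner b b' = 0"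
    by auto
  \<comment> \<open>Real orthogonality to \<open>b\<close> and \<open>\<i> b\<close> amounts to complex orthogonality to \<open>b\<close>, so the real
    self-adjoint eigenvector lemma applies.\<close>
  define C where "C = B \<union> (*s) \<i> ` B"
  define W where "W = {x. \<forall>b\<in>C. b \<bullet> x = 0}"
  have lin: "linear ((*v) A)" by (simp add: bounded_linear.linear)
  have "dim C \<le> card C" using B(1) by (intro dim_le_card') (simp add: C_def)
  also have "\<dots> \<le> card B + card B"
    unfolding C_def by (meson B(1) add_left_mono card_Un_le card_image_le order_trans)
  \<comment> \<open>The real dimension is \<open>2 * CARD('m)\<close>, while \<open>C\<close> has at
    most \<open>2 * k\<close> elements, so a nonzero vector orthogonal to \<open>C\<close>
    remains.\<close>
  also have "\<dots> < DIM(complex^'m)" using Suc.prems B(2) by simp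
  finally obtain u where u: "u \<noteq> 0" "\<And>y. y \<in> span C \<Longrightarrow> orthogonal u y"
    using orthogonal_to_subspace_exists by blast
  have uW: "u \<in> W"
    using u(2) by (auto simp: W_def orthogonal_def inner_commute span_base)
  have W: "subspace W"
    by (auto simp: W_def subspace_def inner_add_right)
  have AC: "\<exists>c. A *v b = c *\<^sub>R b" if "b \<in> C" for b
  proof -
    have "\<exists>c. A *v b = c *\<^sub>R b \<and> A *v (\<i> *s b) = c *\<^sub>R (\<i> *s b)" if "b \<in> B" for b
    proof -
      from B(3)[OF that] obtain c where c: "A *v b = c *\<^sub>R b" by blast
      have "A *v (\<i> *s b) = \<i> *s (c *\<^sub>R b)"
        by (simp add: c vector_scalar_commute)
      also have "\<dots> = c *\<^sub>R (\<i> *s b)" by (simp add: vec_eq_iff)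
      finally show ?thesis using c by blast
    qed
    then show ?thesis using that by (auto simp: C_def)
  qed
  have "(*v) A ` W \<subseteq> W"
  proof clarify
    fix x assume x: "x \<in> W"
    have "b \<bullet> (A *v x) = 0" if "b \<in> C" for b
    proof -
      from AC[OF that] obtain c where "A *v b = c *\<^sub>R b" ..
      then show ?thesis using x that hermitian_inner[OF A, of b x] by (simp add: W_def)
    qed
    then show "A *v x \<in> W" by (simp add: W_def)
  qed
  then obtain x c where x: "x \<in> W" "norm x = 1" "A *v x = c *\<^sub>R x"
    using selfadjoint_eigenvector[OF lin hermitian_inner[OF A] W _ uW u(1)] by blast
  have orth: "cinner b x = 0" "cinner x b = 0" if "b \<in> B" for b
  proof -
    show "cinner b x = 0" using x(1) that by (auto simp: W_def C_def cinner_eq_0_iff)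
    then show "cinner x b = 0" by (metis cnj_cinner complex_cnj_zero)
  qed
  moreover have "cinner x x = 1" using x(2) by (simp add: cinner_self)
  ultimately have "x \<notin> B" by force
  then show ?case
    using B x orth by (intro exI[of _ "insert x B"]) auto
qed


section \<open>Calculus of matrices diagonal in a fixed unitary basis\<close>

text \<open>This is \<open>V diag(d) V^*\<close> written out in entries. With \<open>V\<close>
  fixed, matrix operations become pointwise operations on \<open>d\<close>.\<close>

definition spectral_matrix :: "complex^'m^'m \<Rightarrow> ('m \<Rightarrow> complex) \<Rightarrow> complex^'m^'m" where
  "spectral_matrix V d = (\<chi> a b. \<Sum>j\<in>UNIV. V $ a $ j * d j * cnj (V $ b $ j))"

lemma unitary_columns:
  assumes "unitary_matrix V"
  shows "(\<Sum>a\<in>UNIV. cnj (V $ a $ i) * V $ a $ j) = (if i = j then 1 else 0)"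
proof -
  have "(adjoint_matrix V ** V) $ i $ j = (mat 1 :: complex^_^_) $ i $ j"
    using assms by (simp add: unitary_matrix_def)
  then show ?thesis by (simp add: adjoint_matrix_def matrix_matrix_mult_def mat_def)
qed

lemma spectral_matrix_mult:
  assumes "unitary_matrix V"
  shows "spectral_matrix V d ** spectral_matrix V e = spectral_matrix V (\<lambda>j. d j * e j)"
proof -
  \<comment> \<open>Moving the sum over \<open>k\<close> innermost isolates the orthonormality
    relation of the columns, which collapses the double sum to its diagonal.\<close>
  have "(\<Sum>k\<in>UNIV. (\<Sum>i\<in>UNIV. V $ a $ i * d i * cnj (V $ k $ i)) *
          (\<Sum>j\<in>UNIV. V $ k $ j * e j * cnj (V $ b $ j)))
      = (\<Sum>i\<in>UNIV. \<Sum>j\<in>UNIV. V $ a $ i * d i * e j * cnj (V $ b $ j) *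
          (\<Sum>k\<in>UNIV. cnj (V $ k $ i) * V $ k $ j))" for a b
    unfolding sum_product
    by (subst sum.swap, rule sum.cong[OF refl], subst sum.swap)
      (simp add: sum_distrib_left mult_ac)
  then show ?thesis
    by (simp add: spectral_matrix_def matrix_matrix_mult_def vec_eq_iff unitary_columns[OF assms]
        if_distrib sum.delta cong: if_cong) (simp add: mult_ac)
qed

lemma spectral_matrix_one:
  assumes "unitary_matrix V"
  shows "spectral_matrix V (\<lambda>_. 1) = mat 1"
proof -
  have "spectral_matrix V (\<lambda>_. 1) = V ** adjoint_matrix V"
    by (simp add: spectral_matrix_def adjoint_matrix_def matrix_matrix_mult_def vec_eq_iff)
  then show ?thesis using assms by (simp add: unitary_matrix_def)
qed

lemma adjoint_spectral_matrix:
  "adjoint_matrix (spectral_matrix V d) = spectral_matrix V (\<lambda>j. cnj (d j))"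
  by (simp add: spectral_matrix_def adjoint_matrix_def vec_eq_iff mult_ac)

lemma spectral_matrix_add:
  "spectral_matrix V d + spectral_matrix V e = spectral_matrix V (\<lambda>j. d j + e j)"
  by (simp add: spectral_matrix_def vec_eq_iff algebra_simps sum.distrib)

lemma spectral_matrix_diff:
  "spectral_matrix V d - spectral_matrix V e = spectral_matrix V (\<lambda>j. d j - e j)"
  by (simp add: spectral_matrix_def vec_eq_iff algebra_simps sum_subtractf)

lemma spectral_matrix_scaleR:
  "c *\<^sub>R spectral_matrix V d = spectral_matrix V (\<lambda>j. of_real c * d j)"
  by (simp add: spectral_matrix_def vec_eq_iff scaleR_conv_of_real[where 'a = complex]
      sum_distrib_left mult_ac)

lemma unitary_spectral_matrix:
  assumes "unitary_matrix V" "\<And>j. norm (d j) = 1"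
  shows "unitary_matrix (spectral_matrix V d)"
proof -
  have "cnj (d j) * d j = 1" "d j * cnj (d j) = 1" for j
    using assms(2)[of j] by (simp_all add: complex_norm_square[symmetric] mult.commute[of "cnj _"])
  then show ?thesis
    unfolding unitary_matrix_def adjoint_spectral_matrix spectral_matrix_mult[OF assms(1)]
    by (simp add: spectral_matrix_one assms(1))
qed

lemma spectral_matrix_column:
  assumes "unitary_matrix V"
  shows "spectral_matrix V d *v column j V = d j *s column j V"
proof -
  have "(\<Sum>b\<in>UNIV. (\<Sum>i\<in>UNIV. V $ a $ i * d i * cnj (V $ b $ i)) * V $ b $ j)
      = (\<Sum>i\<in>UNIV. V $ a $ i * d i * (\<Sum>b\<in>UNIV. cnj (V $ b $ i) * V $ b $ j))" for a
    by (simp add: sum_distrib_left sum_distrib_right mult_ac) (rule sum.swap)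
  then show ?thesis
    by (simp add: spectral_matrix_def matrix_vector_mult_def column_def vec_eq_iff
        unitary_columns[OF assms] if_distrib sum.delta cong: if_cong)
qed

lemma spectral_matrix_column_real:
  assumes "unitary_matrix V"
  shows "spectral_matrix V (\<lambda>j. of_real (\<theta> j)) *v column j V = \<theta> j *\<^sub>R column j V"
  by (simp add: spectral_matrix_column[OF assms] vec_eq_iff scaleR_conv_of_real[where 'a = complex])

lemma unitary_column_nonzero:
  assumes "unitary_matrix V"
  shows "column j V \<noteq> 0"
proof
  assume "column j V = 0"
  then have "V $ a $ j = 0" for a by (simp add: column_def vec_eq_iff)
  then show False using unitary_columns[OF assms, of j j] by simp
qed

text \<open>Agreement on the columns means \<open>A ** V = B ** V\<close>, and \<open>V\<close>
  cancels against its adjoint.\<close>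

lemma matrix_eq_on_unitary_columns:
  assumes V: "unitary_matrix V" and eq: "\<And>j. A *v column j V = B *v column j V"
  shows "A = B"
proof -
  have "A ** V = B ** V"
    using eq by (simp add: vec_eq_iff matrix_matrix_mult_def matrix_vector_mult_def column_def)
  then show ?thesis
    using V unfolding unitary_matrix_def by (metis matrix_mul_assoc matrix_mul_rid)
qed

text \<open>A full set of \<open>CARD('m)\<close> orthonormal eigenvectors, indexed by
  \<open>'m\<close>, forms the columns of \<open>V\<close>.\<close>

theorem hermitian_spectral:
  fixes A :: "complex^'m^'m"
  assumes A: "hermitian_matrix A"
  obtains V and \<theta> :: "'m \<Rightarrow> real"
  where "unitary_matrix V" "A = spectral_matrix V (\<lambda>j. of_real (\<theta> j))"
proof -
  obtain B where B: "finite B" "card B = CARD('m)"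
    "\<And>b. b \<in> B \<Longrightarrow> norm b = 1 \<and> (\<exists>c. A *v b = c *\<^sub>R b)"
    "\<And>b b'. b \<in> B \<Longrightarrow> b' \<in> B \<Longrightarrow> b \<noteq> b' \<Longrightarrow> cinner b b' = 0"
    using hermitian_orthonormal_eigenvectors[OF A order_refl] by blast
  then obtain v :: "'m \<Rightarrow> complex^'m" where v: "bij_betw v UNIV B"
    using finite_same_card_bij[of "UNIV :: 'm set" B] by auto
  have vB: "v j \<in> B" for j using v by (auto simp: bij_betw_def)
  have "\<forall>j. \<exists>c. A *v v j = c *\<^sub>R v j" using B(3)[OF vB] by blast
  then obtain \<theta> where \<theta>: "\<And>j. A *v v j = \<theta> j *\<^sub>R v j" by metis
  define V :: "complex^'m^'m" where "V = (\<chi> a j. v j $ a)"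
  have col: "column j V = v j" for j by (simp add: V_def column_def vec_eq_iff)
  have "cinner (v i) (v j) = (if i = j then 1 else 0)" for i j
  proof (cases "i = j")
    case True
    then show ?thesis using B(3)[OF vB[of j]] by (simp add: cinner_self)
  next
    case False
    then have "v i \<noteq> v j" using v by (auto simp: bij_betw_def inj_on_def)
    then show ?thesis using B(4) vB False by auto
  qed
  then have "adjoint_matrix V ** V = mat 1"
    by (simp add: V_def adjoint_matrix_def matrix_matrix_mult_def mat_def cinner_def vec_eq_iff)
  then have V: "unitary_matrix V"
    unfolding unitary_matrix_def by (metis matrix_left_right_inverse)
  have "A = spectral_matrix V (\<lambda>j. of_real (\<theta> j))"
    by (rule matrix_eq_on_unitary_columns[OF V])
      (simp only: spectral_matrix_column_real[OF V], simp only: col \<theta>)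
  with V show thesis using that by blast
qed

text \<open>Multiplying by \<open>- \<i>\<close> turns a skew-Hermitian matrix into a Hermitian one,
  so its eigenvalues are \<open>\<i>\<close> times real numbers.\<close>

corollary skew_hermitian_spectral:
  fixes A :: "complex^'m^'m"
  assumes A: "skew_hermitian_matrix A"
  obtains V and \<theta> :: "'m \<Rightarrow> real"
  where "unitary_matrix V" "A = spectral_matrix V (\<lambda>j. \<i> * of_real (\<theta> j))"
proof -
  define B :: "complex^'m^'m" where "B = (\<chi> a b. - \<i> * A $ a $ b)"
  have "cnj (A $ b $ a) = - A $ a $ b" for a b
    using A by (simp add: skew_hermitian_matrix_def adjoint_matrix_def vec_eq_iff)
  then have "hermitian_matrix B"
    by (simp add: hermitian_matrix_def B_def adjoint_matrix_def vec_eq_iff)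
  then obtain V and \<theta> :: "'m \<Rightarrow> real" where V: "unitary_matrix V"
    and eq: "B = spectral_matrix V (\<lambda>j. of_real (\<theta> j))"
    by (rule hermitian_spectral)
  have "A $ a $ b = \<i> * B $ a $ b" for a b by (simp add: B_def)
  then have "A = spectral_matrix V (\<lambda>j. \<i> * of_real (\<theta> j))"
    by (simp add: eq spectral_matrix_def vec_eq_iff sum_distrib_left mult_ac)
  with V show thesis using that by blast
qed

section \<open>Positive definite matrices and uniqueness of the polar factor\<close>

lemma hermitian_pos_def_iff:
  "hermitian_pos_def A \<longleftrightarrow> hermitian_matrix A \<and> (\<forall>x. x \<noteq> 0 \<longrightarrow> 0 < x \<bullet> (A *v x))"
  unfolding hermitian_pos_def_def Re_cinner[symmetric] cinner_def ..

text \<open>With the Hermitian square root \<open>R\<close> obtained from \<open>sqrt (d j)\<close>,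
  the form equals the squared norm of \<open>R *v x\<close>, and \<open>R\<close> is
  injective.\<close>

lemma hermitian_pos_def_spectral_matrix:
  assumes V: "unitary_matrix V" and d: "\<And>j. 0 < d j"
  shows "hermitian_pos_def (spectral_matrix V (\<lambda>j. of_real (d j)))"
  unfolding hermitian_pos_def_iff
proof (intro conjI allI impI)
  show "hermitian_matrix (spectral_matrix V (\<lambda>j. of_real (d j)))"
    by (simp add: hermitian_matrix_def adjoint_spectral_matrix)
  let ?R = "spectral_matrix V (\<lambda>j. of_real (sqrt (d j)))"
  have sq: "spectral_matrix V (\<lambda>j. of_real (d j)) = ?R ** ?R"
    using less_imp_le[OF d] by (simp add: spectral_matrix_mult[OF V] flip: of_real_mult)
  have inv: "spectral_matrix V (\<lambda>j. of_real (1 / sqrt (d j))) ** ?R = mat 1"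
    using d by (simp add: spectral_matrix_mult[OF V] spectral_matrix_one[OF V]
        less_imp_neq[symmetric] flip: of_real_mult)
  fix x :: "complex^'a" assume "x \<noteq> 0"
  then have "?R *v x \<noteq> 0"
    by (metis inv matrix_vector_mul_assoc matrix_vector_mul_lid matrix_vector_mult_0_right)
  moreover have "x \<bullet> (spectral_matrix V (\<lambda>j. of_real (d j)) *v x) = (?R *v x) \<bullet> (?R *v x)"
    unfolding sq matrix_vector_mul_assoc[symmetric]
    by (rule hermitian_inner) (simp add: hermitian_matrix_def adjoint_spectral_matrix)
  ultimately show "0 < x \<bullet> (spectral_matrix V (\<lambda>j. of_real (d j)) *v x)" by simp
qed

text \<open>Uniqueness of the positive square root: on an eigenvector of \<open>K\<close> with
  eigenvalue \<theta>, the product of \<open>H + \<theta>\<close> and \<open>H - \<theta>\<close>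
  vanishes, and \<open>H + \<theta>\<close> is injective.\<close>

lemma hermitian_pos_def_square_inject:
  assumes H: "hermitian_pos_def H" and K: "hermitian_pos_def K" and eq: "H ** H = K ** K"
  shows "H = K"
proof -
  obtain V \<theta> where V: "unitary_matrix V" and K': "K = spectral_matrix V (\<lambda>j. of_real (\<theta> j))"
    using K by (auto simp: hermitian_pos_def_def elim: hermitian_spectral)
  show ?thesis
  proof (rule matrix_eq_on_unitary_columns[OF V])
    fix j
    let ?v = "column j V"
    have Kv: "K *v ?v = \<theta> j *\<^sub>R ?v"
      by (simp add: K' spectral_matrix_column_real[OF V])
    have "0 < ?v \<bullet> (K *v ?v)"
      using K unitary_column_nonzero[OF V] by (simp add: hermitian_pos_def_iff)
    then have pos: "0 < \<theta> j"
      unfolding Kv inner_scaleR_right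
      by (rule zero_less_mult_pos2) (simp add: unitary_column_nonzero[OF V])
    have lin: "A *v (c *\<^sub>R x) = c *\<^sub>R (A *v x)" for A :: "complex^'a^'a" and c x
      by (simp add: linear_scale bounded_linear.linear)
    \<comment> \<open>If nonzero, \<open>y\<close> would be an eigenvector of \<open>H\<close> for
      the negative eigenvalue \<open>- \<theta> j\<close>, against positive definiteness.\<close>
    define y where "y = H *v ?v - \<theta> j *\<^sub>R ?v"
    have "H *v (H *v ?v) = K *v (K *v ?v)" by (simp add: matrix_vector_mul_assoc eq)
    then have "H *v y = - \<theta> j *\<^sub>R y"
      by (simp add: y_def matrix_vector_mult_diff_distrib Kv lin algebra_simps)
    then have "y \<bullet> (H *v y) = - (\<theta> j * (y \<bullet> y))" by simp
    moreover have "\<theta> j * (y \<bullet> y) \<ge> 0" using pos by simp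
    ultimately have "y = 0" using H by (force simp: hermitian_pos_def_iff)
    then show "H *v ?v = K *v ?v" by (simp add: y_def Kv)
  qed
qed

text \<open>The product of the adjoint of \<open>U ** H\<close> with \<open>U ** H\<close> is
  \<open>H ** H\<close>, which determines \<open>H\<close>. Since \<open>H\<close> is invertible,
  \<open>U\<close> is then determined as well, so the definite description is justified.\<close>

lemma polar_unitary_eq:
  assumes U: "unitary_matrix U" and H: "hermitian_pos_def H"
  shows "polar_unitary (U ** H) = U"
  unfolding polar_unitary_def
proof (rule the_equality)
  fix U' assume "unitary_matrix U' \<and> (\<exists>K. hermitian_pos_def K \<and> U ** H = U' ** K)"
  then obtain K where U': "unitary_matrix U'" and K: "hermitian_pos_def K"
    and eq: "U ** H = U' ** K" by blast
  have sq: "adjoint_matrix (W ** L) ** (W ** L) = L ** L"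
    if "unitary_matrix W" "hermitian_pos_def L" for W L :: "complex^'a^'a"
    using that unfolding unitary_matrix_def hermitian_pos_def_def hermitian_matrix_def adjoint_mult
    by (metis matrix_mul_assoc matrix_mul_lid)
  have "H = K"
    using sq[OF U H] sq[OF U' K] eq by (intro hermitian_pos_def_square_inject[OF H K]) simp
  have "\<forall>x. H *v x = 0 \<longrightarrow> x = 0"
    using H by (force simp: hermitian_pos_def_iff)
  then obtain L where "L ** H = mat 1" using matrix_left_invertible_ker by blast
  then have "H ** L = mat 1" by (simp add: matrix_left_right_inverse)
  then show "U' = U" using eq \<open>H = K\<close> by (metis matrix_mul_assoc matrix_mul_rid)
qed (use assms in blast)

text \<open>Each scalar splits as \<open>d j = sgn (d j) * norm (d j)\<close>: the phases form a
  unitary matrix and the moduli a positive definite one.\<close>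

lemma polar_unitary_spectral:
  assumes "unitary_matrix U" and V: "unitary_matrix V" and d: "\<And>j. d j \<noteq> 0"
  shows "polar_unitary (U ** spectral_matrix V d) = U ** spectral_matrix V (\<lambda>j. sgn (d j))"
proof -
  have "sgn (d j) * of_real (norm (d j)) = d j" for j
    using d[of j] by (simp add: sgn_eq)
  then have "U ** spectral_matrix V d
      = (U ** spectral_matrix V (\<lambda>j. sgn (d j))) ** spectral_matrix V (\<lambda>j. of_real (norm (d j)))"
    by (simp add: spectral_matrix_mult[OF V] flip: matrix_mul_assoc)
  then show ?thesis
    using assms by (simp add: polar_unitary_eq unitary_mult unitary_spectral_matrix norm_sgn
        hermitian_pos_def_spectral_matrix)
qed

lemma invertible_spectral_imp_nonzero:
  fixes U V :: "complex^'m^'m"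
  assumes V: "unitary_matrix V" and inv: "invertible (U ** spectral_matrix V d)"
  shows "d j \<noteq> 0"
proof
  assume "d j = 0"
  then have "(U ** spectral_matrix V d) *v column j V = 0"
    by (simp add: spectral_matrix_column[OF V] flip: matrix_vector_mul_assoc)
  moreover have "\<forall>x. (U ** spectral_matrix V d) *v x = 0 \<longrightarrow> x = 0"
    using inv by (simp add: invertible_left_inverse matrix_left_invertible_ker)
  ultimately show False using unitary_column_nonzero[OF V] by blast
qed

section \<open>The matrix exponential in a unitary basis\<close>

lemma matrix_pow_spectral_matrix:
  assumes "unitary_matrix V"
  shows "matrix_pow (spectral_matrix V d) k = spectral_matrix V (\<lambda>j. d j ^ k)"
  by (induction k)
    (simp_all add: matrix_pow_def spectral_matrix_one[OF assms] spectral_matrix_mult[OF assms])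

text \<open>Convergence is checked entrywise, where the series is a finite linear combination of
  scalar exponential series.\<close>

lemma matrix_exp_spectral_matrix:
  assumes V: "unitary_matrix V"
  shows "matrix_exp (spectral_matrix V d) = spectral_matrix V (\<lambda>j. exp (d j))"
proof -
  have "(\<lambda>k. spectral_matrix V (\<lambda>j. d j ^ k /\<^sub>R fact k)) sums spectral_matrix V (\<lambda>j. exp (d j))"
    unfolding sums_def
  proof (intro vec_tendstoI)
    fix a b
    have "(\<lambda>k. \<Sum>j\<in>UNIV. V $ a $ j * (d j ^ k /\<^sub>R fact k) * cnj (V $ b $ j)) sums
        (\<Sum>j\<in>UNIV. V $ a $ j * exp (d j) * cnj (V $ b $ j))"
      by (intro sums_sum sums_mult sums_mult2 exp_converges)
    then show "(\<lambda>n. (\<Sum>k<n. spectral_matrix V (\<lambda>j. d j ^ k /\<^sub>R fact k)) $ a $ b)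
        \<longlonglongrightarrow> spectral_matrix V (\<lambda>j. exp (d j)) $ a $ b"
      by (simp add: sums_def spectral_matrix_def)
  qed
  then show ?thesis
    unfolding matrix_exp_def matrix_pow_spectral_matrix[OF V]
    by (simp add: spectral_matrix_scaleR sums_iff scaleR_conv_of_real[where 'a = complex] divide_inverse)
qed

section \<open>Scalar estimates for chord and arc\<close>

lemma sin_minus_self_bound: "\<bar>sin x - x\<bar> \<le> \<bar>x\<bar> ^ 3 / 6" for x :: real
  using Maclaurin_sin_bound[of x 3] by (simp add: sin_coeff_def numeral_eq_Suc)

text \<open>In the right half-plane \<open>cmod w - Re w\<close> is at most
  \<open>\<bar>Im w\<bar>\<close>, so \<open>w\<close> is within \<open>2 * \<bar>Im w\<bar>\<close>
  of its modulus. Dividing by \<open>cmod w\<close>, which is at least 1/2, gives the factor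
  4.\<close>

lemma cmod_sgn_minus_1_le:
  assumes "1 / 2 \<le> Re w"
  shows "cmod (sgn w - 1) \<le> 4 * \<bar>Im w\<bar>"
proof -
  have w: "1 / 2 \<le> cmod w" using assms complex_Re_le_cmod[of w] by linarith
  have "cmod w - Re w \<le> \<bar>Im w\<bar>" using cmod_le[of w] assms by simp
  moreover have "cmod (w - of_real (cmod w)) \<le> \<bar>Re w - cmod w\<bar> + \<bar>Im w\<bar>"
    using cmod_le[of "w - of_real (cmod w)"] by simp
  ultimately have *: "cmod (w - of_real (cmod w)) \<le> 2 * \<bar>Im w\<bar>"
    using complex_Re_le_cmod[of w] by linarith
  have "sgn w - 1 = (w - of_real (cmod w)) / of_real (cmod w)"
    using w by (auto simp: sgn_eq diff_divide_distrib)
  then have "cmod (sgn w - 1) = cmod (w - of_real (cmod w)) / cmod w"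
    by (simp add: norm_divide)
  also have "\<dots> \<le> 2 * \<bar>Im w\<bar> / (1 / 2)" using * w by (intro frac_le) auto
  finally show ?thesis by simp
qed

lemma sgn_chord_minus_arc_bound:
  fixes s \<phi> :: real
  assumes s: "s \<in> {0..1}" and \<phi>: "\<bar>\<phi>\<bar> \<le> 1"
  shows "cmod (sgn (of_real (1 - s) + of_real s * cis \<phi>) - cis (s * \<phi>)) \<le> 2 * \<bar>\<phi>\<bar> ^ 3"
proof -
  \<comment> \<open>The chord point is rotated back by \<open>s * \<phi>\<close>, so that the arc
    point becomes 1 and only the phase of \<open>w\<close> has to be estimated.\<close>
  define w where "w = of_real (1 - s) * cis (- (s * \<phi>)) + of_real s * cis ((1 - s) * \<phi>)"
  have z: "of_real (1 - s) + of_real s * cis \<phi> = cis (s * \<phi>) * w"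
    unfolding w_def by (simp add: distrib_left mult.left_commute cis_mult algebra_simps)
  have cos_ge: "1 / 2 \<le> cos (c * \<phi>)" if "c \<in> {0..1}" for c
  proof -
    have "\<bar>sin (c * \<phi> / 2)\<bar> \<le> \<bar>c * \<phi> / 2\<bar>" by (rule abs_sin_x_le_abs_x)
    also have "\<dots> \<le> 1 / 2" using that \<phi> mult_mono[of "\<bar>c\<bar>" 1 "\<bar>\<phi>\<bar>" 1] by (simp add: abs_mult)
    finally have "(sin (c * \<phi> / 2))\<^sup>2 \<le> (1 / 2)\<^sup>2" by (simp add: abs_le_square_iff[symmetric])
    then show ?thesis
      using cos_double_sin[of "c * \<phi> / 2"] by (simp add: power2_eq_square)
  qed
  have sin_le: "\<bar>sin (c * \<phi>) - c * \<phi>\<bar> \<le> \<bar>\<phi>\<bar> ^ 3 / 6" if "c \<in> {0..1}" for c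
  proof -
    have "\<bar>c * \<phi>\<bar> ^ 3 \<le> \<bar>\<phi>\<bar> ^ 3"
      using that by (intro power_mono) (auto simp: abs_mult mult_left_le_one_le)
    then show ?thesis using sin_minus_self_bound[of "c * \<phi>"] by linarith
  qed
  have "(1 - s) * (1 / 2) + s * (1 / 2) \<le> (1 - s) * cos (s * \<phi>) + s * cos ((1 - s) * \<phi>)"
    using s cos_ge[of s] cos_ge[of "1 - s"] by (intro add_mono mult_left_mono) auto
  also have "\<dots> = Re w" by (simp add: w_def)
  finally have Re: "1 / 2 \<le> Re w" by (simp add: field_simps)
  \<comment> \<open>The linear terms \<open>s * (1 - s) * \<phi>\<close> of the two sines cancel,
    which leaves only remainders of third order.\<close>
  have "Im w = s * (sin ((1 - s) * \<phi>) - (1 - s) * \<phi>) - (1 - s) * (sin (s * \<phi>) - s * \<phi>)"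
    by (simp add: w_def algebra_simps)
  also have "\<bar>\<dots>\<bar> \<le> s * \<bar>sin ((1 - s) * \<phi>) - (1 - s) * \<phi>\<bar> + (1 - s) * \<bar>sin (s * \<phi>) - s * \<phi>\<bar>"
    using s by (intro order_trans[OF abs_triangle_ineq4]) (simp add: abs_mult)
  also have "\<dots> \<le> s * (\<bar>\<phi>\<bar> ^ 3 / 6) + (1 - s) * (\<bar>\<phi>\<bar> ^ 3 / 6)"
    using s sin_le[of s] sin_le[of "1 - s"] by (intro add_mono mult_left_mono) auto
  also have "\<dots> = \<bar>\<phi>\<bar> ^ 3 / 6" by (simp add: field_simps)
  finally have Im: "\<bar>Im w\<bar> \<le> \<bar>\<phi>\<bar> ^ 3 / 6" .
  have "sgn (cis (s * \<phi>) * w) - cis (s * \<phi>) = cis (s * \<phi>) * (sgn w - 1)"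
    by (simp add: sgn_mult algebra_simps)
  then have "cmod (sgn (cis (s * \<phi>) * w) - cis (s * \<phi>)) = cmod (sgn w - 1)"
    by (simp add: norm_mult)
  also have "\<dots> \<le> 2 * \<bar>\<phi>\<bar> ^ 3" using cmod_sgn_minus_1_le[OF Re] Im by simp
  finally show ?thesis unfolding z .
qed

lemma sgn_half_chord:
  assumes "0 < cos (\<phi> / 2)"
  shows "sgn (of_real (1 - 1 / 2) + of_real (1 / 2) * cis \<phi>) = cis (\<phi> / 2)"
proof -
  have "of_real (1 - 1 / 2) + of_real (1 / 2) * cis \<phi> = of_real (cos (\<phi> / 2)) * cis (\<phi> / 2)"
    using cos_double_cos[of "\<phi> / 2"] sin_double[of "\<phi> / 2"]
    by (simp add: complex_eq_iff power2_eq_square field_simps)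
  moreover have "sgn (complex_of_real (cos (\<phi> / 2))) = 1"
    using assms by (simp add: sgn_eq)
  moreover have "sgn (cis (\<phi> / 2)) = cis (\<phi> / 2)" by (simp add: sgn_eq)
  ultimately show ?thesis by (simp add: sgn_mult)
qed

text \<open>Serves in contrapositive form: a nonsingular midpoint excludes zeros of the
  cosine.\<close>

lemma half_chord_zero:
  assumes "cos (\<phi> / 2) = 0"
  shows "of_real (1 - 1 / 2) + of_real (1 / 2) * cis \<phi> = 0"
  using assms cos_double_cos[of "\<phi> / 2"] sin_double[of "\<phi> / 2"]
  by (simp add: complex_eq_iff)


section \<open>Passage from scalars to matrices\<close>

text \<open>The product depends linearly on the diagonal \<open>d\<close>, and linear maps on a
  finite-dimensional space are bounded. The constant does not depend on \<open>d\<close>, hence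
  later not on \<open>t\<close>.\<close>

lemma norm_mult_spectral_matrix_le:
  fixes U V :: "complex^'m^'m"
  obtains C where "0 < C"
    "\<And>d. norm (U ** spectral_matrix V d) \<le> C * (\<Sum>j\<in>UNIV. norm (d j))"
proof -
  let ?f = "\<lambda>x. U ** spectral_matrix V (($) x)"
  have "U ** (c *\<^sub>R X) = c *\<^sub>R (U ** X)" for c :: real and X :: "complex^'m^'m"
    by (simp add: matrix_matrix_mult_def vec_eq_iff scaleR_sum_right)
  moreover have "($) (x + y) = (\<lambda>j. x $ j + y $ j)"
      "($) (c *\<^sub>R x) = (\<lambda>j. of_real c * x $ j)" for x y :: "complex^'m" and c
    by (auto simp: scaleR_conv_of_real[where 'a = complex])
  ultimately have "linear ?f"
    by (intro linearI)
      (simp_all add: matrix_add_ldistrib flip: spectral_matrix_add spectral_matrix_scaleR)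
  then obtain C where C: "0 < C" "\<And>x. norm (?f x) \<le> norm x * C"
    by (metis bounded_linear.pos_bounded linear_conv_bounded_linear)
  have "norm (U ** spectral_matrix V d) \<le> C * (\<Sum>j\<in>UNIV. norm (d j))" for d
  proof -
    have "($) (\<chi> j. d j) = d" by auto
    then have "norm (U ** spectral_matrix V d) \<le> norm (\<chi> j. d j) * C" using C(2) by metis
    also have "norm (\<chi> j. d j) \<le> (\<Sum>j\<in>UNIV. norm (d j))"
      using L2_set_le_sum[of UNIV "\<lambda>j. norm (d j)"] by (simp add: norm_vec_def)
    finally show ?thesis using C(1) by (simp add: mult.commute mult_right_mono)
  qed
  with C(1) show thesis by (rule that)
qed

text \<open>Intermediate value theorem: the cosine is 1 at 0, so a nonpositive value on the interval
  would force a zero.\<close>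

lemma cos_half_pos_of_nonzero:
  fixes T :: "real set"
  assumes T: "is_interval T" "0 \<in> T" and nz: "\<And>t. t \<in> T \<Longrightarrow> cos (t * c / 2) \<noteq> 0"
    and t: "t \<in> T"
  shows "0 < cos (t * c / 2)"
proof (rule ccontr)
  assume neg: "\<not> ?thesis"
  have "connected ((\<lambda>t. cos (t * c / 2)) ` T)"
    using T(1) by (intro connected_continuous_image continuous_intros)
      (auto simp: is_interval_connected)
  then have "0 \<in> (\<lambda>t. cos (t * c / 2)) ` T"
    using neg t T(2) by (rule_tac connectedD_interval[of _ "cos (t * c / 2)" 1]) force+
  then show False using nz by auto
qed

theorem proposition2p6:
  fixes U1 \<Omega> :: "complex^'m^'m"
    and U2 :: "real \<Rightarrow> complex^'m^'m"
    and T :: "real set"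
  assumes "unitary_matrix U1"
    and "skew_hermitian_matrix \<Omega>"
    and "is_interval T" and "0 \<in> T"
    and "\<And>t. t \<in> T \<Longrightarrow> U2 t = U1 ** matrix_exp (t *\<^sub>R \<Omega>)"
    and "\<And>t s. t \<in> T \<Longrightarrow> s \<in> {0..1} \<Longrightarrow> invertible ((1 - s) *\<^sub>R U1 + s *\<^sub>R U2 t)"
  shows "(\<forall>s \<in> {0..<1/2} \<union> {1/2<..1}.
           (\<lambda>t. norm (polar_unitary ((1 - s) *\<^sub>R U1 + s *\<^sub>R U2 t)
                      - U1 ** matrix_exp ((s * t) *\<^sub>R \<Omega>)))
             \<in> O[at 0 within T](\<lambda>t. t ^ 3))
       \<and> (\<forall>t \<in> T. polar_unitary ((1 - 1/2) *\<^sub>R U1 + (1/2) *\<^sub>R U2 t)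
           = U1 ** matrix_exp ((1/2 * t) *\<^sub>R \<Omega>))"
proof -
  obtain V \<theta> where V: "unitary_matrix V"
    and \<Omega>: "\<Omega> = spectral_matrix V (\<lambda>j. \<i> * of_real (\<theta> j))"
    using assms(2) by (rule skew_hermitian_spectral)
  have exp: "matrix_exp (t *\<^sub>R \<Omega>) = spectral_matrix V (\<lambda>j. cis (t * \<theta> j))" for t
    by (simp add: \<Omega> spectral_matrix_scaleR matrix_exp_spectral_matrix[OF V] cis_conv_exp mult_ac)
  define z where "z s t j = of_real (1 - s) + of_real s * cis (t * \<theta> j)" for s t j
  have scale: "U1 ** (c *\<^sub>R X) = c *\<^sub>R (U1 ** X)" for c :: real and X :: "complex^'m^'m"
    by (simp add: matrix_matrix_mult_def vec_eq_iff scaleR_sum_right)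
  have chord: "(1 - s) *\<^sub>R U1 + s *\<^sub>R U2 t = U1 ** spectral_matrix V (z s t)" if "t \<in> T" for s t
  proof -
    \<comment> \<open>Writing the identity as \<open>spectral_matrix V\<close> of the constant 1
      puts both endpoints of the chord into the same eigenbasis.\<close>
    have "(1 - s) *\<^sub>R U1 + s *\<^sub>R U2 t
        = U1 ** ((1 - s) *\<^sub>R spectral_matrix V (\<lambda>_. 1) + s *\<^sub>R matrix_exp (t *\<^sub>R \<Omega>))"
      by (simp add: assms(5)[OF that] matrix_add_ldistrib scale spectral_matrix_one[OF V])
    then show ?thesis
      by (simp add: exp spectral_matrix_scaleR spectral_matrix_add z_def[abs_def])
  qed
  have nz: "z s t j \<noteq> 0" if "t \<in> T" "s \<in> {0..1}" for s t j
    using assms(6)[OF that] unfolding chord[OF that(1)]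
    by (rule invertible_spectral_imp_nonzero[OF V])
  have polar: "polar_unitary ((1 - s) *\<^sub>R U1 + s *\<^sub>R U2 t)
      = U1 ** spectral_matrix V (\<lambda>j. sgn (z s t j))" if "t \<in> T" "s \<in> {0..1}" for s t
    unfolding chord[OF that(1)] using assms(1) V nz[OF that] by (rule polar_unitary_spectral)
  show ?thesis
  proof (intro conjI ballI)
    fix s :: real assume "s \<in> {0..<1/2} \<union> {1/2<..1}"
    then have s: "s \<in> {0..1}" by auto
    obtain C where C: "0 < C"
      "\<And>d. norm (U1 ** spectral_matrix V d) \<le> C * (\<Sum>j\<in>UNIV. norm (d j))"
      using norm_mult_spectral_matrix_le[of U1 V] by blast
    \<comment> \<open>A common bound for all \<open>\<bar>\<theta> j\<bar>\<close>. The summand 1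
      keeps it positive, and \<open>\<bar>t\<bar> < 1 / K\<close> then ensures the condition
      \<open>\<bar>t * \<theta> j\<bar> \<le> 1\<close> of the scalar estimate.\<close>
    define K where "K = (\<Sum>j\<in>UNIV. \<bar>\<theta> j\<bar>) + 1"
    have K: "0 < K" "\<bar>\<theta> j\<bar> \<le> K" for j
      using member_le_sum[of j UNIV "\<lambda>j. \<bar>\<theta> j\<bar>"] sum_nonneg[of UNIV "\<lambda>j. \<bar>\<theta> j\<bar>"]
      unfolding K_def by force+
    have bound: "norm (polar_unitary ((1 - s) *\<^sub>R U1 + s *\<^sub>R U2 t)
        - U1 ** matrix_exp ((s * t) *\<^sub>R \<Omega>)) \<le> C * (CARD('m) * (2 * K ^ 3)) * \<bar>t\<bar> ^ 3"
      if t: "t \<in> T" "\<bar>t\<bar> < 1 / K" for t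
    proof -
      have "cmod (sgn (z s t j) - cis (s * t * \<theta> j)) \<le> 2 * K ^ 3 * \<bar>t\<bar> ^ 3" for j
      proof -
        have le: "\<bar>t * \<theta> j\<bar> \<le> \<bar>t\<bar> * K"
          using K(2)[of j] by (simp add: abs_mult mult_left_mono)
        also have "\<dots> \<le> 1" using t(2) K(1) by (simp add: field_simps)
        finally have "cmod (sgn (z s t j) - cis (s * (t * \<theta> j))) \<le> 2 * \<bar>t * \<theta> j\<bar> ^ 3"
          unfolding z_def by (rule sgn_chord_minus_arc_bound[OF s])
        also have "\<dots> \<le> 2 * (\<bar>t\<bar> * K) ^ 3"
          using le by (intro mult_left_mono power_mono) auto
        finally show ?thesis by (simp add: power_mult_distrib mult_ac)
      qed
      then have sum: "(\<Sum>j\<in>UNIV. cmod (sgn (z s t j) - cis (s * t * \<theta> j)))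
          \<le> CARD('m) * (2 * K ^ 3 * \<bar>t\<bar> ^ 3)"
        by (intro sum_bounded_above)
      have "polar_unitary ((1 - s) *\<^sub>R U1 + s *\<^sub>R U2 t) - U1 ** matrix_exp ((s * t) *\<^sub>R \<Omega>)
          = U1 ** spectral_matrix V (\<lambda>j. sgn (z s t j) - cis (s * t * \<theta> j))"
        unfolding polar[OF t(1) s] exp spectral_matrix_diff[symmetric]
        by (simp add: matrix_matrix_mult_def vec_eq_iff algebra_simps sum_subtractf)
      then have "norm (polar_unitary ((1 - s) *\<^sub>R U1 + s *\<^sub>R U2 t)
            - U1 ** matrix_exp ((s * t) *\<^sub>R \<Omega>))
          \<le> C * (\<Sum>j\<in>UNIV. cmod (sgn (z s t j) - cis (s * t * \<theta> j)))"
        using C(2) by simp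
      also have "\<dots> \<le> C * (CARD('m) * (2 * K ^ 3 * \<bar>t\<bar> ^ 3))"
        using sum C(1) by (intro mult_left_mono) auto
      finally show ?thesis by (simp add: mult_ac)
    qed
    have "\<forall>\<^sub>F t in at 0 within T. t \<in> T \<and> \<bar>t\<bar> < 1 / K"
      using K(1) by (auto simp: eventually_at intro!: exI[of _ "1 / K"])
    then show "(\<lambda>t. norm (polar_unitary ((1 - s) *\<^sub>R U1 + s *\<^sub>R U2 t)
                      - U1 ** matrix_exp ((s * t) *\<^sub>R \<Omega>)))
             \<in> O[at 0 within T](\<lambda>t. t ^ 3)"
      by (intro bigoI[of _ "C * (CARD('m) * (2 * K ^ 3))"], elim eventually_mono)
        (use bound in \<open>simp add: power_abs\<close>)
  next
    fix t assume t: "t \<in> T"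
    \<comment> \<open>Nonsingularity at \<open>s = 1/2\<close> for every parameter in
      \<open>T\<close> excludes zeros of the cosine on the whole interval, which fixes its
      sign.\<close>
    have "0 < cos (t * \<theta> j / 2)" for j
    proof (rule cos_half_pos_of_nonzero[OF assms(3,4) _ t])
      fix t assume "t \<in> T"
      then show "cos (t * \<theta> j / 2) \<noteq> 0"
        using nz[of t "1 / 2" j] half_chord_zero[of "t * \<theta> j"] by (auto simp: z_def)
    qed
    then have "sgn (z (1 / 2) t j) = cis (1 / 2 * t * \<theta> j)" for j
      using sgn_half_chord[of "t * \<theta> j"] by (simp add: z_def)
    then show "polar_unitary ((1 - 1/2) *\<^sub>R U1 + (1/2) *\<^sub>R U2 t)
           = U1 ** matrix_exp ((1/2 * t) *\<^sub>R \<Omega>)"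
      using t by (subst polar) (simp_all add: exp)
  qed
qed

end
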